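(* Let $(Hw)(z) = -z w_{zz} - 3 w_z + \frac14 (z^2 w)_z$ for $z<0$. Let $w$ be a smooth solution of the evolution problem $w_t = Hw$ in a subset of $H^1(\mathbb{R}^-)$. Then, there exist positive constants $\alpha$ and $C$ such that $$\| w(t) \|_{L^{\infty}(\mathbb{R}^-)} \leq C \| w(0) \|_{H^1(\mathbb{R}^-)} e^{-\alpha t}.$$
   Context: $\mathbb{R}^- = (-\infty,0)$; $t \geq 0$; functions are real-valued. $H$ is regarded as an operator in $L^2(\mathbb{R}^-)$ with domain ${\rm Dom}(H) = \{ w \in L^2(\mathbb{R}^-) : Hw \in L^2(\mathbb{R}^-)\}$. A smooth solution in a subset of $H^1(\mathbb{R}^-)$ means a solution $w(t,\cdot) \in {\rm Dom}(H)\cap H^1(\mathbb{R}^-)$ with sufficient smoothness in $z$ up to $z=0$ and in $t$, and sufficient decay as $z \to -\infty$. *)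

theory Defs
  imports "HOL-Analysis.Analysis" "HOL-Probability.Essential_Supremum"
begin

abbreviation half_line :: "real measure"
  where "half_line \<equiv> lebesgue_on {..<0}"

text \<open>Functions on the half-line \<open>z < 0\<close> are total functions on the reals; their values at
  \<open>z \<ge> 0\<close> play no role in anything below.\<close>

definition L2 :: "(real \<Rightarrow> real) set"
  where "L2 = {u. u \<in> borel_measurable half_line \<and> integrable half_line (\<lambda>z. (u z)\<^sup>2)}"

definition L2_norm :: "(real \<Rightarrow> real) \<Rightarrow> real"
  where "L2_norm u = sqrt (LINT z|half_line. (u z)\<^sup>2)"

definition Linf_norm :: "(real \<Rightarrow> real) \<Rightarrow> ereal"
  where "Linf_norm u = esssup half_line (\<lambda>z. ereal \<bar>u z\<bar>)"

definition L1_loc :: "(real \<Rightarrow> real) set"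
  where "L1_loc = {u. \<forall>a b. b < 0 \<longrightarrow> set_integrable lebesgue {a..b} u}"

text \<open>Weak derivatives are tested against compactly supported \<open>C\<^sup>1\<close> functions, which in one
  dimension is equivalent to testing against compactly supported smooth functions.\<close>

definition test_fun :: "(real \<Rightarrow> real) \<Rightarrow> bool"
  where "test_fun \<phi> \<longleftrightarrow>
    (\<forall>z. \<phi> differentiable (at z)) \<and> continuous_on UNIV (deriv \<phi>) \<and>
    (\<exists>K. compact K \<and> K \<subseteq> {..<0} \<and> (\<forall>z. z \<notin> K \<longrightarrow> \<phi> z = 0))"

definition has_weak_deriv :: "(real \<Rightarrow> real) \<Rightarrow> (real \<Rightarrow> real) \<Rightarrow> bool"
  where "has_weak_deriv u g \<longleftrightarrow> u \<in> L1_loc \<and> g \<in> L1_loc \<and>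
    (\<forall>\<phi>. test_fun \<phi> \<longrightarrow>
      (LINT z|half_line. u z * deriv \<phi> z) = - (LINT z|half_line. g z * \<phi> z))"

definition weakly_differentiable :: "(real \<Rightarrow> real) \<Rightarrow> bool"
  where "weakly_differentiable u \<longleftrightarrow> (\<exists>g. has_weak_deriv u g)"

text \<open>The weak derivative is determined only up to a null set, so \<open>weak_deriv u\<close> is an arbitrary
  representative, to be used only under integrals or almost everywhere.\<close>

definition weak_deriv :: "(real \<Rightarrow> real) \<Rightarrow> real \<Rightarrow> real"
  where "weak_deriv u = (SOME g. has_weak_deriv u g)"

definition H1 :: "(real \<Rightarrow> real) set"
  where "H1 = {u \<in> L2. \<exists>g \<in> L2. has_weak_deriv u g}"

definition H1_norm :: "(real \<Rightarrow> real) \<Rightarrow> real"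
  where "H1_norm u = sqrt ((L2_norm u)\<^sup>2 + (L2_norm (weak_deriv u))\<^sup>2)"

definition H_op :: "(real \<Rightarrow> real) \<Rightarrow> real \<Rightarrow> real"
  where "H_op w = (\<lambda>z. - z * weak_deriv (weak_deriv w) z - 3 * weak_deriv w z
           + 1/4 * weak_deriv (\<lambda>y. y\<^sup>2 * w y) z)"

text \<open>Since the leading coefficient \<open>-z\<close> is smooth and does not vanish on \<open>z < 0\<close>, any \<open>w \<in> L2\<close>
  whose distributional image under the operator lies in \<open>L2\<close> is automatically twice weakly
  differentiable; the two differentiability conditions only make \<open>H_op w\<close> meaningful.\<close>

definition Dom_H :: "(real \<Rightarrow> real) set"
  where "Dom_H = {w \<in> L2. weakly_differentiable w \<and> weakly_differentiable (weak_deriv w) \<and>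
           H_op w \<in> L2}"

text \<open>For \<open>w\<close> depending on \<open>(t, z)\<close>: classical partial derivatives (one-sided in time at
  \<open>t = 0\<close>), and continuity up to the boundary \<open>t = 0\<close>, \<open>z = 0\<close> of the quarter-plane.\<close>

definition dz :: "nat \<Rightarrow> (real \<Rightarrow> real \<Rightarrow> real) \<Rightarrow> real \<Rightarrow> real \<Rightarrow> real"
  where "dz j w = (\<lambda>t. (deriv ^^ j) (w t))"

definition dt :: "(real \<Rightarrow> real \<Rightarrow> real) \<Rightarrow> real \<Rightarrow> real \<Rightarrow> real"
  where "dt w = (\<lambda>t z. vector_derivative (\<lambda>s. w s z) (at t within {0..}))"

definition continuous_up_to_boundary :: "(real \<Rightarrow> real \<Rightarrow> real) \<Rightarrow> bool"
  where "continuous_up_to_boundary u \<longleftrightarrow>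
    (\<exists>U. continuous_on ({0..} \<times> {..0}) U \<and> (\<forall>t\<ge>0. \<forall>z<0. U (t, z) = u t z))"

text \<open>Sufficient smoothness: \<open>C\<^sup>3\<close> in \<open>z\<close> and \<open>C\<^sup>1\<close> in \<open>t\<close>, so that the equation may be
  differentiated once in \<open>z\<close>.\<close>

definition sufficiently_smooth :: "(real \<Rightarrow> real \<Rightarrow> real) \<Rightarrow> bool"
  where "sufficiently_smooth w \<longleftrightarrow>
    (\<forall>t\<ge>0. \<forall>z<0. \<forall>j<3. dz j w t differentiable (at z)) \<and>
    (\<forall>j\<le>3. continuous_up_to_boundary (dz j w)) \<and>
    (\<forall>t\<ge>0. \<forall>z<0. (\<lambda>s. w s z) differentiable (at t within {0..})) \<and>
    continuous_up_to_boundary (dt w)"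

text \<open>Sufficient decay, locally uniformly in time. The order 2 is the natural one: the transport
  part \<open>(z\<^sup>2 w)\<^sub>z / 4\<close>, dominant at infinity, annihilates \<open>z\<^sup>-\<^sup>2\<close>, and eigenfunctions
  decay exactly like \<open>z\<^sup>-\<^sup>2\<close>. A faster rate would exclude them.\<close>

definition sufficient_decay :: "(real \<Rightarrow> real \<Rightarrow> real) \<Rightarrow> bool"
  where "sufficient_decay w \<longleftrightarrow>
    (\<forall>T\<ge>0. \<exists>M. \<forall>t\<in>{0..T}. \<forall>z<0. \<forall>j\<le>3. (1 + \<bar>z\<bar>)\<^sup>2 * \<bar>dz j w t z\<bar> \<le> M)"

definition smooth_solution :: "(real \<Rightarrow> real \<Rightarrow> real) \<Rightarrow> bool"
  where "smooth_solution w \<longleftrightarrow>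
    sufficiently_smooth w \<and> sufficient_decay w \<and>
    (\<forall>t\<ge>0. w t \<in> Dom_H \<inter> H1) \<and>
    (\<forall>t\<ge>0. AE z in half_line. dt w t z = H_op (w t) z)"

end

theory Submission
  imports Defs
begin

text \<open>The energy \<open>E = \<integral> w\<^sup>2 + w\<^sub>z\<^sup>2\<close> satisfies \<open>E' \<le> - E\<close>. Integration by parts turns \<open>E' + E\<close> into boundary
  terms plus \<open>\<integral> 2 z ((w\<^sub>z - w/2)\<^sup>2 + (w\<^sub>z\<^sub>z - w\<^sub>z/2)\<^sup>2 + w\<^sub>z\<^sup>2/2)\<close>, which is nonpositive because \<open>z < 0\<close>;
  the boundary terms at \<open>z = 0\<close> have the right sign and those at \<open>- \<infinity>\<close> vanish. With
  \<open>w(z)\<^sup>2 \<le> \<integral> 2 \<bar>w w\<^sub>z\<bar> \<le> E\<close> this gives the claim for \<open>\<alpha> = 1/2\<close> and \<open>C = 1\<close>. The energy is taken over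
  \<open>[- 1/\<epsilon>, - \<epsilon>]\<close>, where all integrands are continuous; the decay bounds make the boundary terms
  \<open>O(\<epsilon>)\<close>, uniformly on bounded time intervals.\<close>

section \<open>Weak and classical derivatives\<close>

text \<open>The support is enclosed in an interval, so that integrals against \<open>\<phi>\<close>
  reduce to a compact interval away from 0. The derivative vanishes off that interval because
  \<open>\<phi>\<close> is zero on its open complement.\<close>

lemma test_fun_support:
  assumes "test_fun \<phi>"
  obtains a b where "a \<le> b" "b < 0" "\<And>z. z \<notin> {a..b} \<Longrightarrow> \<phi> z = 0" "\<And>z. z \<notin> {a..b} \<Longrightarrow> deriv \<phi> z = 0"
proof -
  obtain K where K: "compact K" "K \<subseteq> {..<0}" "\<And>z. z \<notin> K \<Longrightarrow> \<phi> z = 0"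
    using assms unfolding test_fun_def by blast
  obtain a b where ab: "a \<le> b" "b < 0" "K \<subseteq> {a..b}"
  proof (cases "K = {}")
    case True
    \<comment> \<open>An empty support has no extrema; any interval inside z < 0 serves.\<close>
    then show ?thesis using that[of "-1" "-1"] by auto
  next
    case False
    obtain l where l: "l \<in> K" "\<And>x. x \<in> K \<Longrightarrow> l \<le> x" using compact_attains_inf[OF K(1) False] by blast
    obtain u where u: "u \<in> K" "\<And>x. x \<in> K \<Longrightarrow> x \<le> u" using compact_attains_sup[OF K(1) False] by blast
    show ?thesis using that[of l u] l u K(2) by force
  qed
  have z: "\<phi> z = 0" if "z \<notin> {a..b}" for z using that ab K by blast
  have "deriv \<phi> z = 0" if "z \<notin> {a..b}" for z
  proof -
    have "open (- {a..b})" by (intro open_Compl closed_atLeastAtMost)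
    moreover have "((\<lambda>_. 0) has_field_derivative 0) (at z)" by simp
    ultimately have "(\<phi> has_field_derivative 0) (at z)"
      using DERIV_cong_ev[of z z "\<lambda>_. 0" \<phi> 0 0] that z eventually_nhds[of "\<lambda>y. 0 = \<phi> y" z]
      by (metis ComplI Compl_iff)
    then show ?thesis by (rule DERIV_imp_deriv)
  qed
  with z ab show ?thesis using that by blast
qed

lemma test_fun_DERIV: "test_fun \<phi> \<Longrightarrow> (\<phi> has_real_derivative deriv \<phi> z) (at z)"
  unfolding test_fun_def by (simp add: DERIV_deriv_iff_real_differentiable)

lemma test_fun_continuous: "test_fun \<phi> \<Longrightarrow> continuous_on A \<phi>"
  by (meson DERIV_isCont continuous_at_imp_continuous_on test_fun_DERIV)

lemma test_fun_continuous_deriv: "test_fun \<phi> \<Longrightarrow> continuous_on A (deriv \<phi>)"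
  unfolding test_fun_def using continuous_on_subset by blast

section \<open>Local integrability and integrals over the half-line\<close>

lemma L1_loc_mult_continuous:
  assumes "u \<in> L1_loc" "continuous_on {a..b} \<psi>" "b < 0"
  shows "(\<lambda>z. u z * \<psi> z) absolutely_integrable_on {a..b}"
proof -
  have "(\<lambda>z. \<psi> z * u z) absolutely_integrable_on {a..b}"
    using assms compact_imp_bounded[OF compact_continuous_image[OF assms(2)]]
    by (intro absolutely_integrable_bounded_measurable_product_real)
       (auto simp: L1_loc_def intro: continuous_imp_measurable_on_sets_lebesgue)
  then show ?thesis by (simp add: mult.commute)
qed

text \<open>A bridge between the Lebesgue integral over \<open>half_line\<close>, in which weak
  derivatives are defined, and the gauge integral over \<open>{a..b}\<close>, for which the
  fundamental theorem of calculus is available.\<close>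

lemma half_line_integral_supported:
  fixes f :: "real \<Rightarrow> real"
  assumes "f absolutely_integrable_on {a..b}" "b < 0" "\<And>z. z \<notin> {a..b} \<Longrightarrow> f z = 0"
  shows "integrable half_line f" "(LINT z|half_line. f z) = integral {a..b} f"
proof -
  have eq: "(\<lambda>z. indicator {..<0} z *\<^sub>R f z) = (\<lambda>z. indicator {a..b} z *\<^sub>R f z)"
    using assms(2,3) by (force simp: indicator_def fun_eq_iff)
  show "integrable half_line f"
    using assms(1)[unfolded set_integrable_def, folded eq] by (subst integrable_restrict_space) auto
  show "(LINT z|half_line. f z) = integral {a..b} f"
    using set_lebesgue_integral_eq_integral(2)[OF assms(1)]
    by (subst integral_restrict_space) (simp_all only: eq set_lebesgue_integral_def, simp_all)
qed

text \<open>Truncations to compact intervals that exhaust the half-line are integrable, hence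
  measurable, and converge pointwise.\<close>

lemma L1_loc_measurable:
  assumes "u \<in> L1_loc"
  shows "u \<in> borel_measurable half_line"
proof (rule borel_measurable_LIMSEQ_real)
  let ?f = "\<lambda>n z. indicator {- real n..- (1 / real (Suc n))} z *\<^sub>R u z"
  show "?f n \<in> borel_measurable half_line" for n
    using assms by (intro measurable_restrict_space1 borel_measurable_integrable)
      (auto simp: L1_loc_def set_integrable_def)
  fix z assume "z \<in> space half_line"
  then have z: "z < 0" by simp
  have "\<forall>\<^sub>F n in sequentially. - real n \<le> z"
    using eventually_ge_at_top[of "nat \<lceil>- z\<rceil>"] by eventually_elim linarith
  moreover have "(\<lambda>n. - (1 / real (Suc n))) \<longlonglongrightarrow> - 0"
    by (intro tendsto_minus) (use LIMSEQ_inverse_real_of_nat in \<open>simp add: inverse_eq_divide\<close>)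
  then have "\<forall>\<^sub>F n in sequentially. z < - (1 / real (Suc n))"
    using z by (intro order_tendstoD(1)) auto
  ultimately have "\<forall>\<^sub>F n in sequentially. ?f n z = u z"
    by eventually_elim (auto simp: indicator_def)
  then show "(\<lambda>n. ?f n z) \<longlonglongrightarrow> u z" by (rule tendsto_eventually)
qed

text \<open>With \<open>p\<close> positive exactly on \<open>(a, b)\<close>, the functions \<open>n p / (1 + n p)\<close> increase to the
  indicator function of \<open>(a, b)\<close>.\<close>

lemma test_fun_approx_indicator:
  fixes a b :: real
  assumes "a < b" "b < 0"
  obtains \<phi> :: "nat \<Rightarrow> real \<Rightarrow> real" where "\<And>n. test_fun (\<phi> n)" "\<And>n z. \<bar>\<phi> n z\<bar> \<le> 1"
    "\<And>n z. z \<notin> {a..b} \<Longrightarrow> \<phi> n z = 0"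
    "\<And>z. (\<lambda>n. \<phi> n z) \<longlonglongrightarrow> indicator {a<..<b} z"
proof -
  define p where "p z = (max 0 (z - a))\<^sup>2 * (max 0 (b - z))\<^sup>2" for z
  define p' where "p' z = 2 * max 0 (z - a) * (max 0 (b - z))\<^sup>2 - (max 0 (z - a))\<^sup>2 * (2 * max 0 (b - z))" for z
  \<comment> \<open>Squaring removes the kink of the positive part, which makes \<open>p\<close>
    continuously differentiable at \<open>a\<close> and \<open>b\<close> too.\<close>
  have sq: "((\<lambda>y. (max 0 y)\<^sup>2) has_real_derivative 2 * max 0 y) (at y)" for y :: real
  proof (rule has_derivative_imp_has_field_derivative[of _ "\<lambda>h. h * (2 * max 0 y)"])
    show "((\<lambda>y. (max 0 y)\<^sup>2) has_derivative (\<lambda>h. h * (2 * max 0 y))) (at y)"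
    proof (rule has_derivativeI_sandwich[of 1])
      fix x assume "x \<noteq> y" 
      \<comment> \<open>In each of the four sign cases the linearisation error is at most
        quadratic.\<close>
      have "\<bar>(max 0 x)\<^sup>2 - (max 0 y)\<^sup>2 - (x - y) * (2 * max 0 y)\<bar> \<le> (x - y)\<^sup>2"
      proof (cases "x \<ge> 0")
        case x: True
        show ?thesis
        proof (cases "y \<ge> 0")
          case True
          have "x\<^sup>2 - y\<^sup>2 - (x - y) * (2 * y) = (x - y)\<^sup>2" by (simp add: power2_eq_square algebra_simps)
          with x True show ?thesis by (simp add: max_def)
        next
          case False
          then have "2 * x * y \<le> 0" using x mult_nonneg_nonpos[of "2 * x" y] by simp
          then have "x\<^sup>2 \<le> (x - y)\<^sup>2" using zero_le_power2[of y] unfolding power2_diff by linarith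
          with x False show ?thesis by (simp add: max_def)
        qed
      next
        case x: False
        show ?thesis
        proof (cases "y \<ge> 0")
          case True
          have "0 \<le> y * (y - 2 * x)" using True x by (intro mult_nonneg_nonneg) auto
          moreover have "y * (y - 2 * x) \<le> (x - y)\<^sup>2" 
            using zero_le_power2[of x] by (simp add: power2_diff power2_eq_square algebra_simps)
          moreover have "- y\<^sup>2 - (x - y) * (2 * y) = y * (y - 2 * x)"
            by (simp add: power2_eq_square algebra_simps)
          ultimately show ?thesis using x True by (simp add: max_def)
        next
          case False
          with x show ?thesis by (simp add: max_def)
        qed
      qed
      also have "\<dots> = \<bar>x - y\<bar> * \<bar>x - y\<bar>" by (simp add: power2_eq_square)
      finally show "norm ((max 0 x)\<^sup>2 - (max 0 y)\<^sup>2 - (x - y) * (2 * max 0 y)) / norm (x - y) \<le> \<bar>x - y\<bar>"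
        using \<open>x \<noteq> y\<close> by (simp add: divide_le_eq)
    next
      show "(\<lambda>x. \<bar>x - y\<bar>) \<midarrow>y\<rightarrow> 0" by (auto intro!: tendsto_eq_intros)
      show "bounded_linear (\<lambda>h. h * (2 * max 0 y))" by (rule bounded_linear_mult_left)
    qed simp
  qed simp
  have dp: "(p has_real_derivative p' z) (at z)" for z
  proof -
    have 1: "((\<lambda>z. (max 0 (z - a))\<^sup>2) has_real_derivative 2 * max 0 (z - a) * 1) (at z)"
      by (rule DERIV_chain2[OF sq]) (auto intro!: derivative_eq_intros)
    have 2: "((\<lambda>z. (max 0 (b - z))\<^sup>2) has_real_derivative 2 * max 0 (b - z) * (-1)) (at z)"
      by (rule DERIV_chain2[OF sq]) (auto intro!: derivative_eq_intros)
    show ?thesis unfolding p_def p'_def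
      by (rule DERIV_cong[OF DERIV_mult[OF 1 2]]) (simp add: algebra_simps)
  qed
  have p0: "p z \<ge> 0" for z unfolding p_def by simp
  define \<phi> where "\<phi> n z = real n * p z / (1 + real n * p z)" for n z
  have pos: "1 + real n * p z > 0" for n z by (simp add: add_pos_nonneg p0)
  have d\<phi>: "(\<phi> n has_real_derivative real n * p' z / (1 + real n * p z)\<^sup>2) (at z)" for n z
  proof -
    have 1: "((\<lambda>z. real n * p z) has_real_derivative real n * p' z) (at z)"
      by (rule DERIV_cmult[OF dp])
    have 2: "((\<lambda>z. 1 + real n * p z) has_real_derivative real n * p' z) (at z)"
      using DERIV_add[OF DERIV_const[of 1] 1] by simp
    have ne: "1 + real n * p z \<noteq> 0" using pos[of n z] by simp
    show ?thesis unfolding \<phi>_def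
      by (rule DERIV_cong[OF DERIV_divide[OF 1 2 ne]])
         (simp add: power2_eq_square algebra_simps)
  qed
  have out: "\<phi> n z = 0" if "z \<notin> {a<..<b}" for n z
    using that unfolding \<phi>_def p_def by (auto simp: max_def)
  have tf: "test_fun (\<phi> n)" for n
    unfolding test_fun_def
  proof (intro conjI allI exI[of _ "{a..b}"] impI)
    show "\<phi> n differentiable at z" for z using d\<phi> real_differentiable_def by blast
    have "deriv (\<phi> n) = (\<lambda>z. real n * p' z / (1 + real n * p z)\<^sup>2)"
      using d\<phi> by (intro ext DERIV_imp_deriv)
    moreover have "continuous_on UNIV p'" unfolding p'_def by (intro continuous_intros)
    moreover have "continuous_on UNIV p" unfolding p_def by (intro continuous_intros)
    moreover have "1 + real n * p z \<noteq> 0" for z using pos[of n z] by simp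
    ultimately show "continuous_on UNIV (deriv (\<phi> n))"
      by (auto intro!: continuous_intros)
  qed (use assms out in auto)
  have bd: "\<bar>\<phi> n z\<bar> \<le> 1" for n z
    using pos[of n z] p0[of z] unfolding \<phi>_def by (simp add: abs_mult)
  have lim: "(\<lambda>n. \<phi> n z) \<longlonglongrightarrow> indicator {a<..<b} z" for z
  proof (cases "z \<in> {a<..<b}")
    case True
    then have pz: "p z > 0" unfolding p_def by (auto simp: max_def)
    have "((\<lambda>n. 1 - 1 / (1 + p z * real n)) \<longlongrightarrow> 1 - 0) sequentially"
      by (intro tendsto_diff tendsto_const tendsto_divide_0[OF tendsto_const] filterlim_at_top_imp_at_infinity
            filterlim_tendsto_add_at_top[OF tendsto_const]
            filterlim_tendsto_pos_mult_at_top[OF tendsto_const] filterlim_real_sequentially pz)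
    moreover have "1 - 1 / (1 + p z * real n) = \<phi> n z" for n
      using pos[of n z] unfolding \<phi>_def by (simp add: field_simps)
    ultimately show ?thesis using True by simp
  qed (use out in auto)
  show ?thesis using that[of \<phi>] tf bd out lim by force
qed

text \<open>The fundamental lemma of the calculus of variations. Dominated convergence along test
  functions that approximate indicators shows that every interval integral of \<open>h\<close>
  vanishes; Lebesgue differentiation then gives \<open>h = 0\<close> almost everywhere.\<close>

lemma L1_loc_eq_zero_AE:
  assumes h: "h \<in> L1_loc" and 0: "\<And>\<phi>. test_fun \<phi> \<Longrightarrow> (LINT z|half_line. h z * \<phi> z) = 0"
  shows "AE z in half_line. h z = 0"
proof -
  have int0: "integral {a..b} h = 0" if "a < b" "b < 0" for a b
  proof -
    obtain \<phi> :: "nat \<Rightarrow> real \<Rightarrow> real" where \<phi>: "\<And>n. test_fun (\<phi> n)" "\<And>n z. \<bar>\<phi> n z\<bar> \<le> 1"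
      "\<And>n z. z \<notin> {a..b} \<Longrightarrow> \<phi> n z = 0"
      "\<And>z. (\<lambda>n. \<phi> n z) \<longlonglongrightarrow> indicator {a<..<b} z"
      using test_fun_approx_indicator[OF \<open>a < b\<close> \<open>b < 0\<close>] by blast
    have abs: "(\<lambda>z. h z * \<phi> n z) absolutely_integrable_on {a..b}" for n
      by (rule L1_loc_mult_continuous[OF h test_fun_continuous[OF \<phi>(1)] \<open>b < 0\<close>])
    have z: "integral {a..b} (\<lambda>z. h z * \<phi> n z) = 0" for n
      using half_line_integral_supported(2)[OF abs \<open>b < 0\<close>] \<phi>(3) 0[OF \<phi>(1)] by simp
    have habs: "h absolutely_integrable_on {a..b}" using h that by (auto simp: L1_loc_def)
    have "(\<lambda>n. integral {a..b} (\<lambda>z. h z * \<phi> n z)) \<longlonglongrightarrow> integral {a..b} (\<lambda>z. h z * indicator {a<..<b} z)"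
    proof (rule dominated_convergence(2))
      show "(\<lambda>z. h z * \<phi> n z) integrable_on {a..b}" for n
        using abs set_lebesgue_integral_eq_integral(1) by blast
      show "(\<lambda>z. \<bar>h z\<bar>) integrable_on {a..b}"
        using habs by (simp add: absolutely_integrable_on_def)
      show "norm (h z * \<phi> n z) \<le> \<bar>h z\<bar>" for n z
        using mult_left_mono[OF \<phi>(2)[of n z] abs_ge_zero[of "h z"]] by (simp add: abs_mult)
      show "(\<lambda>n. h z * \<phi> n z) \<longlonglongrightarrow> h z * indicator {a<..<b} z" for z
        by (intro tendsto_mult tendsto_const \<phi>(4))
    qed
    then have "integral {a..b} (\<lambda>z. h z * indicator {a<..<b} z) = 0"
      using z by (simp add: LIMSEQ_const_iff)
    moreover have "integral {a..b} (\<lambda>z. h z * indicator {a<..<b} z) = integral {a..b} h"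
      by (rule integral_spike[of "{a, b}"]) (auto simp: indicator_def)
    ultimately show ?thesis by simp
  qed
  \<comment> \<open>\<open>h\<close> may fail to be integrable near 0 or at - infinity, so it is
    truncated to intervals exhausting the half-line; the countably many exceptional sets have a
    negligible union.\<close>
  have "\<exists>N. negligible N \<and> (\<forall>x. - real n < x \<and> x < - (1 / real (Suc n)) \<and> x \<notin> N \<longrightarrow> h x = 0)" for n
  proof -
    define S where "S = {- real n..- (1 / real (Suc n))}"
    define f where "f x = (if x \<in> S then h x else 0)" for x
    have hS: "h absolutely_integrable_on S" using h unfolding S_def L1_loc_def by auto
    have "f absolutely_integrable_on UNIV"
      unfolding f_def using hS absolutely_integrable_restrict_UNIV[of S h] by simp
    then have "f integrable_on cbox a b" for a b
      using set_lebesgue_integral_eq_integral(1) integrable_on_subcbox by blast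
    then obtain N where N: "negligible N" "\<And>x e. \<lbrakk>x \<notin> N; 0 < e\<rbrakk> \<Longrightarrow>
               \<exists>d>0. \<forall>k. 0 < k \<and> k < d \<longrightarrow>
                  norm (integral (cbox x (x + k *\<^sub>R One)) f /\<^sub>R k ^ DIM(real) - f x) < e"
      using integrable_ccontinuous_explicit[of f] by blast
    have "h x = 0" if x: "- real n < x" "x < - (1 / real (Suc n))" "x \<notin> N" for x
    proof (rule ccontr)
      assume "h x \<noteq> 0"
      then obtain d where d: "d > 0" "\<And>k. 0 < k \<Longrightarrow> k < d \<Longrightarrow>
          norm (integral (cbox x (x + k *\<^sub>R One)) f /\<^sub>R k ^ DIM(real) - f x) < \<bar>h x\<bar>"
        using N(2)[OF x(3), of "\<bar>h x\<bar>"] by auto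
      \<comment> \<open>Small enough for the average to be close to \<open>f x\<close>, and for
        \<open>[x, x + k]\<close> to stay where \<open>f\<close> agrees with \<open>h\<close>. That
        average is 0, which contradicts \<open>h x \<noteq> 0\<close>.\<close>
      define k where "k = min (d / 2) (- (1 / real (Suc n)) - x)"
      have k: "0 < k" "k < d" "x + k \<le> - (1 / real (Suc n))" using d x unfolding k_def by (auto simp: min_def)
      have "integral {x..x + k} f = integral {x..x + k} h"
        using x k by (intro integral_cong) (auto simp: f_def S_def)
      also have "\<dots> = 0" using k x by (intro int0) (auto intro: order.strict_trans1)
      finally have "norm (0 - f x) < \<bar>h x\<bar>" using d(2)[OF k(1,2)] by simp
      then show False using x by (auto simp: f_def S_def)
    qed
    with N(1) show ?thesis by blast
  qed
  then obtain N where N: "\<And>n. negligible (N n)"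
    "\<And>n x. - real n < x \<Longrightarrow> x < - (1 / real (Suc n)) \<Longrightarrow> x \<notin> N n \<Longrightarrow> h x = 0" by metis
  have "negligible (\<Union>n. N n)" using N(1) by (rule negligible_Union_nat)
  then have null: "(\<Union>n. N n) \<in> null_sets lebesgue" by (simp add: negligible_iff_null_sets)
  have "h x = 0" if "x < 0" "x \<notin> (\<Union>n. N n)" for x
  proof -
    obtain m where m: "- x < real m" using reals_Archimedean2 by blast
    obtain l where l: "inverse (real (Suc l)) < - x" using reals_Archimedean[of "- x"] \<open>x < 0\<close> by auto
    \<comment> \<open>The larger of the two indices handles both ends of the exhausting
      interval.\<close>
    have "inverse (real (Suc (max m l))) \<le> inverse (real (Suc l))" by (intro le_imp_inverse_le) auto
    then show ?thesis using N(2)[of "max m l" x] m l that by (auto simp: inverse_eq_divide)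
  qed
  then have "AE x in lebesgue. x \<in> {..<0} \<longrightarrow> h x = 0"
    by (intro AE_I'[OF null]) auto
  then show ?thesis by (simp add: AE_restrict_space_iff)
qed

text \<open>By the product rule the two integrands add up to the derivative of
  \<open>u \<phi>\<close>, whose boundary values vanish.\<close>

lemma classical_has_weak_deriv:
  assumes d: "\<And>z. z < 0 \<Longrightarrow> (u has_real_derivative u' z) (at z)" and c: "continuous_on {..<0} u'"
  shows "has_weak_deriv u u'"
proof -
  have cu: "continuous_on {..<0} u"
    using d DERIV_isCont by (force intro!: continuous_at_imp_continuous_on)
  have L: "u \<in> L1_loc" "u' \<in> L1_loc"
    using c cu unfolding L1_loc_def
    by (auto intro!: absolutely_integrable_continuous_real intro: continuous_on_subset)
  have "(LINT z|half_line. u z * deriv \<phi> z) = - (LINT z|half_line. u' z * \<phi> z)" if \<phi>: "test_fun \<phi>" for \<phi>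
  proof -
    obtain a b where ab: "a \<le> b" "b < 0" "\<And>z. z \<notin> {a..b} \<Longrightarrow> \<phi> z = 0"
      "\<And>z. z \<notin> {a..b} \<Longrightarrow> deriv \<phi> z = 0" using test_fun_support[OF \<phi>] by metis
    \<comment> \<open>enlarged so that \<open>\<phi>\<close> vanishes at both end points\<close>
    define l r where "l = a - 1" and "r = b / 2"
    have lr: "l \<le> r" "r < 0" "\<And>z. z \<notin> {l..r} \<Longrightarrow> \<phi> z = 0" "\<And>z. z \<notin> {l..r} \<Longrightarrow> deriv \<phi> z = 0"
      "\<phi> l = 0" "\<phi> r = 0"
      using ab unfolding l_def r_def by auto
    have 1: "(\<lambda>z. u z * deriv \<phi> z) absolutely_integrable_on {l..r}"
      by (rule L1_loc_mult_continuous[OF L(1) test_fun_continuous_deriv[OF \<phi>] lr(2)])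
    have 2: "(\<lambda>z. u' z * \<phi> z) absolutely_integrable_on {l..r}"
      by (rule L1_loc_mult_continuous[OF L(2) test_fun_continuous[OF \<phi>] lr(2)])
    have "((\<lambda>z. u z * deriv \<phi> z + u' z * \<phi> z) has_integral u r * \<phi> r - u l * \<phi> l) {l..r}"
    proof (rule fundamental_theorem_of_calculus[OF lr(1)])
      fix z assume "z \<in> {l..r}"
      then have "z < 0" using lr by auto
      then have "((\<lambda>z. u z * \<phi> z) has_real_derivative u z * deriv \<phi> z + u' z * \<phi> z) (at z)"
        using DERIV_mult[OF d test_fun_DERIV[OF \<phi>]] by (simp add: algebra_simps)
      then show "((\<lambda>z. u z * \<phi> z) has_vector_derivative u z * deriv \<phi> z + u' z * \<phi> z) (at z within {l..r})"
        using has_real_derivative_iff_has_vector_derivative has_vector_derivative_at_within by blast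
    qed
    then have "integral {l..r} (\<lambda>z. u z * deriv \<phi> z + u' z * \<phi> z) = 0" using lr by (simp add: integral_unique)
    then have "integral {l..r} (\<lambda>z. u z * deriv \<phi> z) + integral {l..r} (\<lambda>z. u' z * \<phi> z) = 0"
      using integral_add[OF set_lebesgue_integral_eq_integral(1)[OF 1] set_lebesgue_integral_eq_integral(1)[OF 2]]
      by simp
    then show ?thesis
      using half_line_integral_supported(2)[OF 1 lr(2)] half_line_integral_supported(2)[OF 2 lr(2)] lr by simp
  qed
  with L show ?thesis unfolding has_weak_deriv_def by blast
qed

text \<open>The difference of the two derivatives integrates to 0 against every test function. Only
  almost everywhere equality of \<open>u\<close> and \<open>v\<close> is asked for, since a
  representative chosen by \<open>weak_deriv\<close> is known no better than that.\<close>

lemma has_weak_deriv_unique: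
  assumes u: "has_weak_deriv u g" and v: "has_weak_deriv v k" and uv: "AE z in half_line. u z = v z"
  shows "AE z in half_line. g z = k z"
proof -
  have L: "u \<in> L1_loc" "v \<in> L1_loc" "g \<in> L1_loc" "k \<in> L1_loc" using u v by (auto simp: has_weak_deriv_def)
  have "AE z in half_line. g z - k z = 0"
  proof (rule L1_loc_eq_zero_AE)
    show "(\<lambda>z. g z - k z) \<in> L1_loc" using L(3,4) unfolding L1_loc_def by (blast intro: set_integral_diff(1))
    fix \<phi> assume \<phi>: "test_fun \<phi>"
    obtain a b where ab: "a \<le> b" "b < 0" "\<And>z. z \<notin> {a..b} \<Longrightarrow> \<phi> z = 0"
      using test_fun_support[OF \<phi>] by metis
    have i: "integrable half_line (\<lambda>z. f z * \<phi> z)" if "f \<in> L1_loc" for f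
      using L1_loc_mult_continuous[OF that test_fun_continuous[OF \<phi>] ab(2), where a = a] ab(2,3)
      by (intro half_line_integral_supported(1)[where a = a and b = b]) auto
    have [measurable]: "deriv \<phi> \<in> borel_measurable half_line"
      using test_fun_continuous_deriv[OF \<phi>] by (intro continuous_imp_measurable_on_sets_lebesgue) auto
    note [measurable] = L[THEN L1_loc_measurable]
    have "(LINT z|half_line. u z * deriv \<phi> z) = (LINT z|half_line. v z * deriv \<phi> z)"
      using uv by (intro integral_cong_AE) auto
    then have "(LINT z|half_line. g z * \<phi> z) = (LINT z|half_line. k z * \<phi> z)"
      using u v \<phi> by (simp add: has_weak_deriv_def)
    then show "(LINT z|half_line. (g z - k z) * \<phi> z) = 0"
      using i[OF L(3)] i[OF L(4)] by (simp add: left_diff_distrib)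
  qed
  then show ?thesis by simp
qed

text \<open>The almost everywhere hypothesis allows iteration: once \<open>weak_deriv u\<close> is
  identified up to a null set, the lemma applies to \<open>weak_deriv u\<close> in turn.\<close>

lemma weak_deriv_eq_classical:
  assumes "\<And>z. z < 0 \<Longrightarrow> (v has_real_derivative v' z) (at z)" "continuous_on {..<0} v'"
    and "AE z in half_line. u z = v z" "weakly_differentiable u"
  shows "AE z in half_line. weak_deriv u z = v' z"
  using has_weak_deriv_unique[OF _ classical_has_weak_deriv[OF assms(1,2)] assms(3)] assms(4)
  unfolding weakly_differentiable_def weak_deriv_def by (metis someI_ex)

section \<open>The energy estimate\<close>

text \<open>Differentiability of \<open>fz\<close> in time is a conclusion here. Writing
  \<open>f\<close> as a time integral of \<open>ft\<close> and differentiating under the integral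
  sign in z represents \<open>fz\<close> as a time integral of \<open>ftz\<close>, which can be
  differentiated in t.\<close>

lemma mixed_derivative_commute:
  fixes f fz ft ftz :: "real \<Rightarrow> real \<Rightarrow> real"
  assumes dz: "\<And>t z. 0 \<le> t \<Longrightarrow> z < 0 \<Longrightarrow> (f t has_real_derivative fz t z) (at z)"
    and dt: "\<And>t z. 0 \<le> t \<Longrightarrow> z < 0 \<Longrightarrow> ((\<lambda>s. f s z) has_real_derivative ft t z) (at t within {0..})"
    and dtz: "\<And>t z. 0 \<le> t \<Longrightarrow> z < 0 \<Longrightarrow> (ft t has_real_derivative ftz t z) (at z)"
    and ct: "continuous_on ({0..} \<times> {..<0}) (\<lambda>(t, z). ft t z)"
    and ctz: "continuous_on ({0..} \<times> {..<0}) (\<lambda>(t, z). ftz t z)"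
    and t: "0 \<le> t" and z: "z < 0"
  shows "((\<lambda>s. fz s z) has_real_derivative ftz t z) (at t within {0..})"
proof -
  have slice: "continuous_on {0..s} (\<lambda>r. g r y)"
    if "continuous_on ({0..} \<times> {..<0}) (\<lambda>(t, z). g t z)" "y < 0" for g :: "real \<Rightarrow> real \<Rightarrow> real" and s y
    by (rule continuous_on_compose2[OF that(1), of _ "\<lambda>r. (r, y)", simplified])
       (use that in \<open>auto intro!: continuous_intros\<close>)
  have rep: "fz s z = fz 0 z + integral {0..s} (\<lambda>r. ftz r z)" if "0 \<le> s" for s
  proof -
    have f: "f s y = f 0 y + integral {0..s} (\<lambda>r. ft r y)" if "y < 0" for y
    proof -
      have "((\<lambda>r. ft r y) has_integral f s y - f 0 y) {0..s}"
        using dt[OF _ that] \<open>0 \<le> s\<close>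
        by (intro fundamental_theorem_of_calculus[where f = "\<lambda>r. f r y"])
           (auto simp: has_real_derivative_iff_has_vector_derivative
             intro: has_vector_derivative_within_subset[of _ _ _ "{0..}"])
      then show ?thesis by (simp add: integral_unique)
    qed
    have "((\<lambda>y. integral (cbox 0 s) (\<lambda>r. ft r y)) has_real_derivative integral (cbox 0 s) (\<lambda>r. ftz r z))
        (at z within {..<0})"
    proof (rule leibniz_rule_field_derivative)
      show "((\<lambda>y. ft r y) has_real_derivative ftz r y) (at y within {..<0})"
        if "y \<in> {..<0}" "r \<in> cbox 0 s" for y r
        using dtz[of r y] that by (auto intro: DERIV_subset)
      show "(\<lambda>r. ft r y) integrable_on cbox 0 s" if "y \<in> {..<0}" for y
        using slice[OF ct, of y s] that by (auto intro: integrable_continuous_real)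
      show "continuous_on ({..<0} \<times> cbox 0 s) (\<lambda>(y, r). ftz r y)"
        unfolding split_beta
        by (rule continuous_on_compose2[OF ctz, of _ "\<lambda>p. (snd p, fst p)", simplified])
           (auto intro!: continuous_intros)
    qed (use z in auto)
    then have "((\<lambda>y. integral {0..s} (\<lambda>r. ft r y)) has_real_derivative integral {0..s} (\<lambda>r. ftz r z)) (at z)"
      using z by (simp add: at_within_open[of _ "{..<0}"])
    from DERIV_add[OF dz[OF order_refl z] this]
    have "((\<lambda>y. f 0 y + integral {0..s} (\<lambda>r. ft r y)) has_real_derivative
        fz 0 z + integral {0..s} (\<lambda>r. ftz r z)) (at z)" .
    then have "(f s has_real_derivative fz 0 z + integral {0..s} (\<lambda>r. ftz r z)) (at z)"
      by (rule has_field_derivative_transform_within_open[of _ _ _ "{..<0}"]) (use f z in auto)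
    then show ?thesis using DERIV_unique dz[OF that z] by blast
  qed
  \<comment> \<open>The end point \<open>t + 1\<close> keeps \<open>t\<close> away from the right
    end, so that the derivative is one-sided only at \<open>t = 0\<close>.\<close>
  have "((\<lambda>s. fz 0 z + integral {0..s} (\<lambda>r. ftz r z)) has_real_derivative 0 + ftz t z) (at t within {0..t + 1})"
    by (intro DERIV_add DERIV_const integral_has_real_derivative slice[OF ctz z]) (use t in auto)
  moreover have "at t within {0..t + 1} = at t within {0..}"
    by (rule at_within_nhd[of _ "{..<t + 1}"]) (use t in auto)
  ultimately have "((\<lambda>s. fz 0 z + integral {0..s} (\<lambda>r. ftz r z)) has_real_derivative ftz t z) (at t within {0..})"
    by simp
  then show ?thesis
    by (rule has_field_derivative_transform_within[where d = 1]) (use t in \<open>auto intro!: rep[symmetric]\<close>)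
qed

text \<open>The mean value theorem for \<open>exp t * E t\<close>. The error \<open>K\<close> leaves
  room for the boundary terms that survive on a truncated interval.\<close>

lemma exponential_decay_of_differential_inequality:
  fixes E E' :: "real \<Rightarrow> real"
  assumes d: "\<And>t. t \<in> {0..T} \<Longrightarrow> (E has_real_derivative E' t) (at t within {0..T})"
    and K: "\<And>t. t \<in> {0..T} \<Longrightarrow> E' t + E t \<le> K" and "0 \<le> T" "0 \<le> K"
  shows "E T \<le> exp (- T) * E 0 + T * K"
proof (cases "T = 0")
  case False
  then have "0 < T" using \<open>0 \<le> T\<close> by simp
  have "((\<lambda>t. exp t * E t) has_real_derivative exp t * (E' t + E t)) (at t within {0..T})" if "t \<in> {0..T}" for t
    using d[OF that] by (auto intro!: derivative_eq_intros simp: algebra_simps)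
  then have "\<exists>x\<in>{0<..<T}. exp T * E T - exp 0 * E 0 = (*) (exp x * (E' x + E x)) (T - 0)"
    using \<open>0 < T\<close> by (intro mvt_simple) (auto simp: has_field_derivative_def)
  then obtain x where x: "0 < x" "x < T" "exp T * E T - E 0 = T * (exp x * (E' x + E x))"
    by (auto simp: mult.commute)
  have "exp x * (E' x + E x) \<le> exp x * K" using K x by (intro mult_left_mono) auto
  \<comment> \<open>This factor \<open>exp T\<close> cancels against \<open>exp (- T)\<close> below,
    so the error grows only linearly in \<open>T\<close>.\<close>
  also have "\<dots> \<le> exp T * K" using x \<open>0 \<le> K\<close> by (intro mult_right_mono) auto
  finally have "exp T * E T \<le> E 0 + T * (exp T * K)" using x(3) mult_left_mono[OF _ \<open>0 \<le> T\<close>] by fastforce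
  then have "exp (- T) * (exp T * E T) \<le> exp (- T) * (E 0 + T * (exp T * K))" by (rule mult_left_mono) simp
  moreover have "exp (- T) * (exp T * x) = x" for x by (simp add: mult.assoc[symmetric] exp_add[symmetric])
  then have "exp (- T) * (E 0 + T * (exp T * K)) = exp (- T) * E 0 + T * K"
    by (simp add: distrib_left mult.left_commute)
  ultimately show ?thesis by (simp add: mult.assoc[symmetric] exp_add[symmetric])
qed simp

text \<open>The functions \<open>w1\<close>, \<open>w2\<close>, \<open>w3\<close> stand for the
  z-derivatives of the solution \<open>w0\<close>, which keeps weak derivatives and null sets out of
  the energy estimate. The bracket in \<open>evolution\<close> is
  \<open>(z\<^sup>2 w)\<^sub>z / 4\<close> expanded.\<close>

locale classical_solution =
  fixes w0 w1 w2 w3 :: "real \<Rightarrow> real \<Rightarrow> real"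
  assumes d0: "\<And>t z. 0 \<le> t \<Longrightarrow> z < 0 \<Longrightarrow> (w0 t has_real_derivative w1 t z) (at z)"
    and d1: "\<And>t z. 0 \<le> t \<Longrightarrow> z < 0 \<Longrightarrow> (w1 t has_real_derivative w2 t z) (at z)"
    and d2: "\<And>t z. 0 \<le> t \<Longrightarrow> z < 0 \<Longrightarrow> (w2 t has_real_derivative w3 t z) (at z)"
    and c0: "continuous_on ({0..} \<times> {..<0}) (\<lambda>(t, z). w0 t z)"
    and c1: "continuous_on ({0..} \<times> {..<0}) (\<lambda>(t, z). w1 t z)"
    and c2: "continuous_on ({0..} \<times> {..<0}) (\<lambda>(t, z). w2 t z)"
    and c3: "continuous_on ({0..} \<times> {..<0}) (\<lambda>(t, z). w3 t z)"
    and evolution: "\<And>t z. 0 \<le> t \<Longrightarrow> z < 0 \<Longrightarrow> ((\<lambda>s. w0 s z) has_real_derivative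
          - z * w2 t z - 3 * w1 t z + (z\<^sup>2 / 4 * w1 t z + z / 2 * w0 t z)) (at t within {0..})"
    and decay: "\<And>T. 0 \<le> T \<Longrightarrow> \<exists>M. \<forall>t\<in>{0..T}. \<forall>z<0. (1 + \<bar>z\<bar>)\<^sup>2 * \<bar>w0 t z\<bar> \<le> M \<and>
          (1 + \<bar>z\<bar>)\<^sup>2 * \<bar>w1 t z\<bar> \<le> M \<and> (1 + \<bar>z\<bar>)\<^sup>2 * \<bar>w2 t z\<bar> \<le> M"
begin

definition rhs0 :: "real \<Rightarrow> real \<Rightarrow> real"
  where "rhs0 t z = - z * w2 t z - 3 * w1 t z + (z\<^sup>2 / 4 * w1 t z + z / 2 * w0 t z)"

text \<open>The z-derivative of \<open>rhs0\<close>, hence the right-hand side of the equation for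
  \<open>w\<^sub>z\<close>.\<close>

definition rhs1 :: "real \<Rightarrow> real \<Rightarrow> real"
  where "rhs1 t z = - z * w3 t z - 4 * w2 t z + z\<^sup>2 / 4 * w2 t z + z * w1 t z + w0 t z / 2"

text \<open>Half of what the integration by parts leaves at the boundary. The terms with factor
  \<open>- z\<close> come from the highest derivatives and those with \<open>z\<^sup>2 / 8\<close>
  from the transport part. The terms with \<open>z / 2\<close> come from completing squares:
  \<open>z w w\<^sub>z\<close> is \<open>(z w\<^sup>2 / 2)\<^sub>z - w\<^sup>2 / 2\<close>, and this
  last term produces the damping. The coefficient - 3/4 is - 1 from the first equation plus 1/4 from
  \<open>w0 t z / 2\<close> in \<open>rhs1\<close>.\<close>

definition flux :: "real \<Rightarrow> real \<Rightarrow> real"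
  where "flux t z = - z * (w0 t z * w1 t z + w1 t z * w2 t z) - 3 / 4 * (w0 t z)\<^sup>2 - 3 / 2 * (w1 t z)\<^sup>2
    + z\<^sup>2 / 8 * ((w0 t z)\<^sup>2 + (w1 t z)\<^sup>2) + z / 2 * ((w0 t z)\<^sup>2 + (w1 t z)\<^sup>2)"

definition energy :: "real \<Rightarrow> real \<Rightarrow> real \<Rightarrow> real"
  where "energy a b t = integral {a..b} (\<lambda>z. (w0 t z)\<^sup>2 + (w1 t z)\<^sup>2)"

lemma continuous_rhs:
  "continuous_on ({0..} \<times> {..<0}) (\<lambda>(t, z). rhs0 t z)"
  "continuous_on ({0..} \<times> {..<0}) (\<lambda>(t, z). rhs1 t z)"
  using c0 c1 c2 c3 unfolding rhs0_def rhs1_def split_beta by (auto intro!: continuous_intros)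

lemma evolution0:
  "0 \<le> t \<Longrightarrow> z < 0 \<Longrightarrow> ((\<lambda>s. w0 s z) has_real_derivative rhs0 t z) (at t within {0..})"
  unfolding rhs0_def by (rule evolution)

text \<open>The evolution equation differentiated in z; the third z-derivative of the solution
  enters through \<open>rhs1\<close>.\<close>

lemma evolution1:
  assumes "0 \<le> t" "z < 0"
  shows "((\<lambda>s. w1 s z) has_real_derivative rhs1 t z) (at t within {0..})"
proof (rule mixed_derivative_commute[OF d0 evolution0 _ continuous_rhs assms])
  fix t z :: real assume "0 \<le> t" "z < 0"
  note [derivative_intros] = d0[OF this] d1[OF this] d2[OF this]
  show "(rhs0 t has_real_derivative rhs1 t z) (at z)"
    unfolding rhs0_def rhs1_def
    by (auto intro!: derivative_eq_intros simp: field_simps power2_eq_square)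
qed

text \<open>The integration by parts as a pointwise identity, checked by the product rule. The
  squares carry the factor z and therefore have a sign on the half-line.\<close>

lemma flux_derivative:
  assumes "0 \<le> t" "z < 0"
  shows "((\<lambda>z. 2 * flux t z) has_real_derivative
     2 * w0 t z * rhs0 t z + 2 * w1 t z * rhs1 t z + ((w0 t z)\<^sup>2 + (w1 t z)\<^sup>2)
     - 2 * z * ((w1 t z - w0 t z / 2)\<^sup>2 + (w2 t z - w1 t z / 2)\<^sup>2 + (w1 t z)\<^sup>2 / 2)) (at z)"
proof -
  note [derivative_intros] = d0[OF assms] d1[OF assms] d2[OF assms]
  show ?thesis
    unfolding flux_def rhs0_def rhs1_def
    by (auto intro!: derivative_eq_intros simp: field_simps power2_eq_square)
qed

section \<open>Energy balance on compact intervals\<close>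

lemma slice:
  fixes g :: "real \<Rightarrow> real \<Rightarrow> real"
  assumes "0 \<le> t" "b < 0" "continuous_on ({0..} \<times> {..<0}) (\<lambda>(t, z). g t z)"
  shows "continuous_on {a..b} (g t)"
proof -
  have "(\<lambda>z. (t, z)) ` {a..b} \<subseteq> {0..} \<times> {..<0}"
    using assms(1,2) by auto
  from continuous_on_compose2[OF assms(3) _ this] show ?thesis by (simp add: continuous_on_Pair)
qed

lemma energy_derivative:
  assumes "0 \<le> t" "b < 0"
  shows "(energy a b has_real_derivative integral {a..b} (\<lambda>z. 2 * w0 t z * rhs0 t z + 2 * w1 t z * rhs1 t z))
     (at t within {0..})"
proof -
  have "((\<lambda>t. integral (cbox a b) (\<lambda>z. (w0 t z)\<^sup>2 + (w1 t z)\<^sup>2)) has_real_derivative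
     integral (cbox a b) (\<lambda>z. 2 * w0 t z * rhs0 t z + 2 * w1 t z * rhs1 t z)) (at t within {0..})"
  proof (rule leibniz_rule_field_derivative)
    show "((\<lambda>t. (w0 t z)\<^sup>2 + (w1 t z)\<^sup>2) has_real_derivative
        2 * w0 t z * rhs0 t z + 2 * w1 t z * rhs1 t z) (at t within {0..})"
      if "t \<in> {0..}" "z \<in> cbox a b" for t z
      using evolution0[of t z] evolution1[of t z] that assms(2) by (auto intro!: derivative_eq_intros)
    show "(\<lambda>z. (w0 t z)\<^sup>2 + (w1 t z)\<^sup>2) integrable_on cbox a b" if "t \<in> {0..}" for t
      using slice[OF _ assms(2) c0, of t] slice[OF _ assms(2) c1, of t] that
      by (auto intro!: integrable_continuous_real continuous_intros)
    show "continuous_on ({0..} \<times> cbox a b) (\<lambda>(t, z). 2 * w0 t z * rhs0 t z + 2 * w1 t z * rhs1 t z)"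
      by (rule continuous_on_subset[of "{0..} \<times> {..<0}"])
         (use assms(2) c0 c1 continuous_rhs in \<open>auto simp: split_beta intro!: continuous_intros\<close>)
  qed (use assms in auto)
  then show ?thesis by (simp add: energy_def[abs_def])
qed

text \<open>Integrating \<open>flux_derivative\<close> gives an equality; the inequality arises from
  dropping \<open>?R\<close>, which is nonpositive for z < 0.\<close>

lemma energy_inequality:
  assumes "0 \<le> t" "a \<le> b" "b < 0"
  shows "integral {a..b} (\<lambda>z. 2 * w0 t z * rhs0 t z + 2 * w1 t z * rhs1 t z) + energy a b t
    \<le> 2 * flux t b - 2 * flux t a"
proof -
  note cont = slice[OF assms(1,3) c0] slice[OF assms(1,3) c1] slice[OF assms(1,3) c2]
    slice[OF assms(1,3) continuous_rhs(1)] slice[OF assms(1,3) continuous_rhs(2)]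
  let ?P = "\<lambda>z. 2 * w0 t z * rhs0 t z + 2 * w1 t z * rhs1 t z"
  let ?Q = "\<lambda>z. (w0 t z)\<^sup>2 + (w1 t z)\<^sup>2"
  let ?R = "\<lambda>z. 2 * z * ((w1 t z - w0 t z / 2)\<^sup>2 + (w2 t z - w1 t z / 2)\<^sup>2 + (w1 t z)\<^sup>2 / 2)"
  have int: "?P integrable_on {a..b}" "?Q integrable_on {a..b}" 
    by (intro integrable_continuous_real continuous_intros cont)+
  have "((\<lambda>z. ?P z + ?Q z - ?R z) has_integral 2 * flux t b - 2 * flux t a) {a..b}"
  proof (rule fundamental_theorem_of_calculus[OF assms(2), where f = "\<lambda>z. 2 * flux t z"])
    fix z assume "z \<in> {a..b}"
    then have "z < 0" using assms(3) by auto
    from flux_derivative[OF assms(1) this]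
    show "((\<lambda>z. 2 * flux t z) has_vector_derivative ?P z + ?Q z - ?R z) (at z within {a..b})"
      unfolding has_real_derivative_iff_has_vector_derivative[symmetric]
      by (rule has_field_derivative_at_within)
  qed
  moreover have "?R z \<le> 0" if "z \<in> {a..b}" for z
  proof -
    have "2 * z \<le> 0" using that assms(3) by simp
    then show ?thesis by (rule mult_nonpos_nonneg) simp
  qed
  ultimately have "integral {a..b} (\<lambda>z. ?P z + ?Q z) \<le> 2 * flux t b - 2 * flux t a"
    using integral_le[OF integrable_add[OF int], of "\<lambda>z. ?P z + ?Q z - ?R z"]
    by (auto simp: has_integral_iff)
  then show ?thesis using integral_add[OF int] by (simp add: energy_def)
qed

text \<open>Each factor is of order \<open>z\<^sup>-\<^sup>2\<close>, so products are of order
  \<open>z^(-4)\<close> and the weight z leaves \<open>z^(-3)\<close>, here weakened to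
  \<open>1 / - z\<close>. The terms with \<open>z\<^sup>2 / 8\<close> have the favourable sign and
  are dropped.\<close>

lemma flux_bound_left:
  assumes "z \<le> - 1" "z\<^sup>2 * \<bar>w0 t z\<bar> \<le> M" "z\<^sup>2 * \<bar>w1 t z\<bar> \<le> M" "z\<^sup>2 * \<bar>w2 t z\<bar> \<le> M"
  shows "- flux t z \<le> 6 * M\<^sup>2 / - z"
proof -
  define m where "m = M / z\<^sup>2"
  have b: "\<bar>w0 t z\<bar> \<le> m" "\<bar>w1 t z\<bar> \<le> m" "\<bar>w2 t z\<bar> \<le> m"
    using assms unfolding m_def by (auto simp: le_divide_eq mult.commute)
  have pr: "\<bar>x * y\<bar> \<le> m\<^sup>2" if "\<bar>x\<bar> \<le> m" "\<bar>y\<bar> \<le> m" for x y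
    using mult_mono[OF that] that unfolding abs_mult power2_eq_square by auto
  have s: "(w0 t z)\<^sup>2 \<le> m\<^sup>2" "(w1 t z)\<^sup>2 \<le> m\<^sup>2" "\<bar>w0 t z * w1 t z + w1 t z * w2 t z\<bar> \<le> 2 * m\<^sup>2"
    using b pr[OF b(1) b(1)] pr[OF b(2) b(2)] pr[OF b(1) b(2)] pr[OF b(2) b(3)] 
    by (auto simp: power2_eq_square)
  have 1: "z * (w0 t z * w1 t z + w1 t z * w2 t z) \<le> - z * (2 * m\<^sup>2)"
    using mult_left_mono[OF s(3), of "- z"] assms(1) abs_le_D1[of "z * (w0 t z * w1 t z + w1 t z * w2 t z)"]
    by (auto simp: abs_mult)
  have 2: "- z / 2 * ((w0 t z)\<^sup>2 + (w1 t z)\<^sup>2) \<le> - z / 2 * (m\<^sup>2 + m\<^sup>2)"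
    using s assms(1) by (intro mult_left_mono) auto
  have 3: "0 \<le> z\<^sup>2 / 8 * ((w0 t z)\<^sup>2 + (w1 t z)\<^sup>2)" by simp
  have 4: "m\<^sup>2 \<le> - z * m\<^sup>2" using mult_right_mono[of 1 "- z" "m\<^sup>2"] assms(1) by simp
  have "- flux t z = z * (w0 t z * w1 t z + w1 t z * w2 t z) + 3 / 4 * (w0 t z)\<^sup>2 + 3 / 2 * (w1 t z)\<^sup>2
      - z\<^sup>2 / 8 * ((w0 t z)\<^sup>2 + (w1 t z)\<^sup>2) + - z / 2 * ((w0 t z)\<^sup>2 + (w1 t z)\<^sup>2)"
    unfolding flux_def by simp
  also have "\<dots> \<le> - z * (2 * m\<^sup>2) + 3 / 4 * m\<^sup>2 + 3 / 2 * m\<^sup>2 - 0 + - z / 2 * (m\<^sup>2 + m\<^sup>2)"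
    by (intro add_mono diff_mono mult_left_mono 1 2 3 s) auto
  also have "\<dots> = 3 * (- z * m\<^sup>2) + 9 / 4 * m\<^sup>2" by simp
  \<comment> \<open>Since \<open>- z \<ge> 1\<close>, the unweighted 9/4 joins the weighted 3, and
    the sum is rounded up to 6.\<close>
  also have "\<dots> \<le> 6 * (- z * m\<^sup>2)" using 4 zero_le_power2[of m] by linarith
  also have "- z * m\<^sup>2 = M\<^sup>2 / (- z) ^ 3"
    using assms(1) unfolding m_def by (simp add: power2_eq_square power3_eq_cube field_simps)
  also have "M\<^sup>2 / (- z) ^ 3 \<le> M\<^sup>2 / (- z)"
    using assms(1) self_le_power[of "- z" 3] by (intro divide_left_mono mult_pos_pos zero_less_power) auto
  finally show ?thesis by simp
qed

text \<open>The squares without a factor z enter with negative coefficients, so no boundary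
  condition at 0 is required. The remaining positive contributions have a factor \<open>- z\<close>,
  or \<open>z\<^sup>2\<close>, which is at most \<open>- z\<close> here.\<close>

lemma flux_bound_right:
  assumes "- 1 \<le> z" "z < 0" "\<bar>w0 t z\<bar> \<le> M" "\<bar>w1 t z\<bar> \<le> M" "\<bar>w2 t z\<bar> \<le> M"
  shows "flux t z \<le> 3 * M\<^sup>2 * - z"
proof -
  have pr: "\<bar>x * y\<bar> \<le> M\<^sup>2" if "\<bar>x\<bar> \<le> M" "\<bar>y\<bar> \<le> M" for x y
    using mult_mono[OF that] that unfolding abs_mult power2_eq_square by auto
  note b = assms(3-5)
  have s: "(w0 t z)\<^sup>2 \<le> M\<^sup>2" "(w1 t z)\<^sup>2 \<le> M\<^sup>2" "w0 t z * w1 t z + w1 t z * w2 t z \<le> 2 * M\<^sup>2"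
    using b pr[OF b(1) b(1)] pr[OF b(2) b(2)] pr[OF b(1) b(2)] pr[OF b(2) b(3)] 
    by (auto simp: power2_eq_square)
  have 1: "- z * (w0 t z * w1 t z + w1 t z * w2 t z) \<le> - z * (2 * M\<^sup>2)"
    using s(3) assms(2) by (intro mult_left_mono) auto
  have 2: "z / 2 * ((w0 t z)\<^sup>2 + (w1 t z)\<^sup>2) \<le> 0" using assms(2) by (intro mult_nonpos_nonneg) auto
  have "z\<^sup>2 \<le> - z" using assms mult_right_mono[of "- z" 1 "- z"] by (simp add: power2_eq_square)
  then have 3: "z\<^sup>2 / 8 * ((w0 t z)\<^sup>2 + (w1 t z)\<^sup>2) \<le> - z / 8 * (M\<^sup>2 + M\<^sup>2)"
    using s assms(2) by (intro mult_mono) auto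
  have 4: "0 \<le> - z * M\<^sup>2" using assms(2) by (simp add: mult_nonpos_nonneg)
  have "flux t z \<le> - z * (2 * M\<^sup>2) - 0 - 0 + - z / 8 * (M\<^sup>2 + M\<^sup>2) + 0"
    unfolding flux_def by (intro add_mono diff_mono 1 2 3) auto
  also have "\<dots> = 9 / 4 * (- z * M\<^sup>2)" by simp
  also have "\<dots> \<le> 3 * (- z * M\<^sup>2)" using 4 by linarith
  finally show ?thesis by (simp add: mult_ac)
qed

text \<open>The derivative \<open>2 w w\<^sub>z\<close> of \<open>w\<^sup>2\<close> is at most the
  energy density. The value at \<open>a\<close> remains and is later removed by the decay at -
  infinity.\<close>

lemma pointwise_le_energy:
  assumes "0 \<le> t" "a \<le> z" "z \<le> b" "b < 0"
  shows "(w0 t z)\<^sup>2 \<le> (w0 t a)\<^sup>2 + energy a b t"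
proof -
  let ?Q = "\<lambda>z. (w0 t z)\<^sup>2 + (w1 t z)\<^sup>2"
  have int: "?Q integrable_on {a..b}" "?Q integrable_on {a..z}"
    using assms slice[OF assms(1) _ c0] slice[OF assms(1) _ c1]
    by (auto intro!: integrable_continuous_real continuous_intros)
  have "((\<lambda>z. 2 * w0 t z * w1 t z) has_integral (w0 t z)\<^sup>2 - (w0 t a)\<^sup>2) {a..z}"
  proof (rule fundamental_theorem_of_calculus[OF assms(2), where f = "\<lambda>z. (w0 t z)\<^sup>2"])
    fix y assume "y \<in> {a..z}"
    then have "y < 0" using assms(3,4) by auto
    from DERIV_power[OF d0[OF assms(1) this], of 2]
    have "((\<lambda>z. (w0 t z)\<^sup>2) has_real_derivative 2 * w0 t y * w1 t y) (at y)"
      by (simp add: mult_ac)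
    then show "((\<lambda>z. (w0 t z)\<^sup>2) has_vector_derivative 2 * w0 t y * w1 t y) (at y within {a..z})"
      unfolding has_real_derivative_iff_has_vector_derivative[symmetric]
      by (rule has_field_derivative_at_within)
  qed
  moreover have "2 * w0 t y * w1 t y \<le> ?Q y" for y
    by (rule sum_squares_bound)
  ultimately have "(w0 t z)\<^sup>2 - (w0 t a)\<^sup>2 \<le> integral {a..z} ?Q"
    using has_integral_le int(2) by (blast intro: integrable_integral)
  also have "\<dots> \<le> energy a b t"
    unfolding energy_def using assms int by (intro integral_subset_le) auto
  finally show ?thesis by simp
qed

text \<open>\<open>N\<close> bounds the initial energy on all compact intervals at once, so it
  survives the limit in which the truncation is removed.\<close>

lemma pointwise_decay:
  assumes N: "\<And>a b. b < 0 \<Longrightarrow> energy a b 0 \<le> N" and T: "0 \<le> T" and z: "z < 0"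
  shows "(w0 T z)\<^sup>2 \<le> exp (- T) * N"
proof -
  obtain M where M: "\<And>t z. t \<in> {0..T} \<Longrightarrow> z < 0 \<Longrightarrow> (1 + \<bar>z\<bar>)\<^sup>2 * \<bar>w0 t z\<bar> \<le> M \<and>
          (1 + \<bar>z\<bar>)\<^sup>2 * \<bar>w1 t z\<bar> \<le> M \<and> (1 + \<bar>z\<bar>)\<^sup>2 * \<bar>w2 t z\<bar> \<le> M"
    using decay[OF T] by blast
  \<comment> \<open>The decay weight dominates both 1 and \<open>z\<^sup>2\<close>; the former is
    used at the right end, the latter at the left end.\<close>
  have le: "\<bar>x\<bar> \<le> M \<and> z\<^sup>2 * \<bar>x\<bar> \<le> M" if "(1 + \<bar>z\<bar>)\<^sup>2 * \<bar>x\<bar> \<le> M" for x z :: real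
  proof -
    have "(1 + \<bar>z\<bar>)\<^sup>2 * \<bar>x\<bar> = \<bar>x\<bar> + 2 * (\<bar>z\<bar> * \<bar>x\<bar>) + z\<^sup>2 * \<bar>x\<bar>" by (simp add: power2_sum algebra_simps)
    moreover have "0 \<le> \<bar>z\<bar> * \<bar>x\<bar>" "0 \<le> z\<^sup>2 * \<bar>x\<bar>" by auto
    ultimately show ?thesis using that abs_ge_zero[of x] by linarith
  qed
  have bound: "\<bar>w0 t z\<bar> \<le> M" "\<bar>w1 t z\<bar> \<le> M" "\<bar>w2 t z\<bar> \<le> M"
    "z\<^sup>2 * \<bar>w0 t z\<bar> \<le> M" "z\<^sup>2 * \<bar>w1 t z\<bar> \<le> M" "z\<^sup>2 * \<bar>w2 t z\<bar> \<le> M"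
    if "t \<in> {0..T}" "z < 0" for t z
    using M[OF that] le by blast+
  \<comment> \<open>The error collects \<open>M\<^sup>2\<close> from the value at \<open>a\<close>
    and 18 = 2 (3 + 6) from the two flux bounds, over a time \<open>T\<close>. The condition on
    \<open>\<epsilon>\<close> puts z into \<open>[a, b]\<close> and ensures
    \<open>a \<le> - 1 \<le> b\<close>, as the flux bounds demand.\<close>
  have step: "(w0 T z)\<^sup>2 \<le> exp (- T) * N + (M\<^sup>2 + T * (18 * M\<^sup>2)) * \<epsilon>"
    if \<epsilon>: "0 < \<epsilon>" "\<epsilon> < min 1 (min (- z) (1 / - z))" for \<epsilon>
  proof -
    define a b where "a = - (1 / \<epsilon>)" and "b = - \<epsilon>"
    have ab: "a \<le> z" "z \<le> b" "b < 0" "- 1 \<le> b" "a \<le> - 1" "1 / - a = \<epsilon>" "a < 0"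
    proof -
      have "\<epsilon> * - z < 1" using \<epsilon> z by (simp add: field_simps)
      then show "a \<le> z" using \<epsilon> unfolding a_def by (simp add: field_simps)
      show "a \<le> - 1" using \<epsilon> unfolding a_def by (simp add: le_divide_eq)
    qed (use \<epsilon> in \<open>auto simp: a_def b_def\<close>)
    have diff: "integral {a..b} (\<lambda>z. 2 * w0 t z * rhs0 t z + 2 * w1 t z * rhs1 t z) + energy a b t \<le> 18 * M\<^sup>2 * \<epsilon>"
      if "t \<in> {0..T}" for t
    proof -
      have "flux t b \<le> 3 * M\<^sup>2 * - b"
        by (intro flux_bound_right bound that ab)
      moreover have "- flux t a \<le> 6 * M\<^sup>2 / - a"
        by (intro flux_bound_left bound that ab)
      moreover have "6 * M\<^sup>2 / - a = 6 * M\<^sup>2 * \<epsilon>" using ab(6) by (simp add: a_def)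
      ultimately show ?thesis using energy_inequality[of t a b] that ab by (simp add: b_def)
    qed
    have "energy a b T \<le> exp (- T) * energy a b 0 + T * (18 * M\<^sup>2 * \<epsilon>)"
    proof (rule exponential_decay_of_differential_inequality[OF _ diff T])
      show "(energy a b has_real_derivative integral {a..b} (\<lambda>z. 2 * w0 t z * rhs0 t z + 2 * w1 t z * rhs1 t z))
          (at t within {0..T})" if "t \<in> {0..T}" for t
        using energy_derivative[of t b a] that ab by (auto intro: DERIV_subset)
    qed (use \<epsilon> in auto)
    also have "exp (- T) * energy a b 0 \<le> exp (- T) * N" using N[OF ab(3)] by (intro mult_left_mono) auto
    finally have "energy a b T \<le> exp (- T) * N + T * (18 * M\<^sup>2 * \<epsilon>)" by simp
    moreover have "(w0 T a)\<^sup>2 \<le> M\<^sup>2 * \<epsilon>"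
    proof -
      have x: "a\<^sup>2 * \<bar>w0 T a\<bar> \<le> M" using bound(4)[of T a] T ab by auto
      have "\<bar>w0 T a\<bar> \<le> M * \<epsilon>\<^sup>2"
        using x \<epsilon> unfolding a_def by (simp add: power2_eq_square field_simps)
      then have "(w0 T a)\<^sup>2 \<le> (M * \<epsilon>\<^sup>2)\<^sup>2" by (rule abs_le_square_iff[THEN iffD1, OF order_trans]) simp
      also have "\<dots> = M\<^sup>2 * \<epsilon> ^ 4" by (simp add: power_mult_distrib flip: power_mult)
      also have "\<dots> \<le> M\<^sup>2 * \<epsilon>" using \<epsilon> power_decreasing[of 1 4 \<epsilon>] by (intro mult_left_mono) auto
      finally show ?thesis .
    qed
    moreover have "(w0 T z)\<^sup>2 \<le> (w0 T a)\<^sup>2 + energy a b T"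
      using pointwise_le_energy T ab by blast
    ultimately show ?thesis by (simp add: algebra_simps)
  qed
  \<comment> \<open>\<open>M\<close> does not depend on \<open>\<epsilon>\<close>, so the whole
    error vanishes as \<open>\<epsilon>\<close> tends to 0 from the right.\<close>
  have "((\<lambda>\<epsilon>. exp (- T) * N + (M\<^sup>2 + T * (18 * M\<^sup>2)) * \<epsilon>) \<longlongrightarrow>
      exp (- T) * N + (M\<^sup>2 + T * (18 * M\<^sup>2)) * 0) (at_right 0)"
    by (intro tendsto_intros)
  moreover have "\<forall>\<^sub>F \<epsilon> in at_right 0. (w0 T z)\<^sup>2 \<le> exp (- T) * N + (M\<^sup>2 + T * (18 * M\<^sup>2)) * \<epsilon>"
    unfolding eventually_at_right_field
    by (intro exI[of _ "min 1 (min (- z) (1 / - z))"]) (use step z in auto)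
  ultimately show ?thesis using tendsto_lowerbound by fastforce
qed

end

section \<open>Smooth solutions\<close>

text \<open>The set where the functions differ is open and null, hence empty.\<close>

lemma continuous_AE_eq_half_line:
  fixes f g :: "real \<Rightarrow> real"
  assumes "continuous_on {..<0} f" "continuous_on {..<0} g" "AE z in half_line. f z = g z" "z < 0"
  shows "f z = g z"
proof (rule ccontr)
  let ?S = "{z \<in> {..<0}. f z - g z \<noteq> 0}"
  assume "f z \<noteq> g z"
  then have "?S \<noteq> {}" using assms(4) by auto
  have "open ?S"
    using continuous_open_preimage[OF continuous_on_diff[OF assms(1,2)] open_lessThan, of "- {0}"]
    by (simp add: vimage_def Int_def open_Compl)
  then have "?S \<in> sets lebesgue" by (simp add: borel_open)
  moreover have "AE z in lebesgue. z \<notin> ?S"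
    using assms(3) by (simp add: AE_restrict_space_iff)
  ultimately have "negligible ?S" by (simp add: negligible_iff_null_sets AE_iff_null_sets)
  then show False using open_not_negligible \<open>open ?S\<close> \<open>?S \<noteq> {}\<close> by blast
qed

section \<open>Reduction of smooth solutions to classical ones\<close>

lemma continuous_up_to_boundary_interior:
  assumes "continuous_up_to_boundary u"
  shows "continuous_on ({0..} \<times> {..<0}) (\<lambda>(t, z). u t z)"
proof -
  obtain U where "continuous_on ({0..} \<times> {..0}) U" "\<forall>t\<ge>0. \<forall>z<0. U (t, z) = u t z"
    using assms unfolding continuous_up_to_boundary_def by blast
  then show ?thesis
    by (auto intro!: continuous_on_eq[of "{0..} \<times> {..<0}" U] elim!: continuous_on_subset)
qed

lemma continuous_up_to_boundary_slice:
  assumes "continuous_up_to_boundary u" "0 \<le> t"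
  shows "continuous_on {..<0} (u t)"
proof -
  have "(\<lambda>z. (t, z)) ` {..<0} \<subseteq> {0..} \<times> {..<0}" using assms(2) by auto
  from continuous_on_compose2[OF continuous_up_to_boundary_interior[OF assms(1)] _ this]
  show ?thesis by (simp add: continuous_on_Pair)
qed

lemma dz_0 [simp]: "dz 0 w t = w t"
  by (simp add: dz_def)

lemma smooth_solution_dz_DERIV:
  assumes "smooth_solution w" "0 \<le> t" "z < 0" "j < 3"
  shows "(dz j w t has_real_derivative dz (Suc j) w t z) (at z)"
proof -
  have "dz j w t differentiable (at z)"
    using assms unfolding smooth_solution_def sufficiently_smooth_def by blast
  then show ?thesis by (simp add: dz_def DERIV_deriv_iff_real_differentiable)
qed

lemma smooth_solution_dz_continuous:
  assumes "smooth_solution w" "j \<le> 3"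
  shows "continuous_up_to_boundary (dz j w)"
  using assms unfolding smooth_solution_def sufficiently_smooth_def by blast

text \<open>The equation is given only almost everywhere and through weak derivatives. These agree
  almost everywhere with the classical ones, and both sides are then continuous, so equality holds
  at every point.\<close>

lemma smooth_solution_dt:
  assumes w: "smooth_solution w" and t: "0 \<le> t" and z: "z < 0"
  shows "dt w t z = - z * dz 2 w t z - 3 * dz 1 w t z + (z\<^sup>2 / 4 * dz 1 w t z + z / 2 * dz 0 w t z)"
proof (rule continuous_AE_eq_half_line[OF _ _ _ z])
  note d = smooth_solution_dz_DERIV[OF w t] and c = smooth_solution_dz_continuous[OF w, THEN continuous_up_to_boundary_slice, OF _ t]
  have d0: "(w t has_real_derivative dz 1 w t y) (at y)" if "y < 0" for y
    using d[OF that, of 0] by simp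
  have d1: "(dz 1 w t has_real_derivative dz 2 w t y) (at y)" if "y < 0" for y
    using d[OF that, of 1] by (simp add: numeral_2_eq_2)
  have c0: "continuous_on {..<0} (w t)" and c1: "continuous_on {..<0} (dz 1 w t)"
    and c2: "continuous_on {..<0} (dz 2 w t)"
    using c[of 0] c[of 1] c[of 2] by simp_all
  have D: "w t \<in> Dom_H" using w t unfolding smooth_solution_def by blast
  have "continuous_up_to_boundary (dt w)"
    using w unfolding smooth_solution_def sufficiently_smooth_def by blast
  then show "continuous_on {..<0} (dt w t)" using t by (rule continuous_up_to_boundary_slice)
  show "continuous_on {..<0} (\<lambda>z. - z * dz 2 w t z - 3 * dz 1 w t z + (z\<^sup>2 / 4 * dz 1 w t z + z / 2 * dz 0 w t z))"
    using c0 c1 c2 by (auto intro!: continuous_intros)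
  have 1: "AE y in half_line. weak_deriv (w t) y = dz 1 w t y"
    using D by (intro weak_deriv_eq_classical[OF d0 c1]) (auto simp: Dom_H_def)
  \<comment> \<open>Fact \<open>1\<close> supplies the almost everywhere agreement of
    \<open>weak_deriv (w t)\<close> with a differentiable function.\<close>
  have 2: "AE y in half_line. weak_deriv (weak_deriv (w t)) y = dz 2 w t y"
    using D by (intro weak_deriv_eq_classical[OF d1 c2 1]) (auto simp: Dom_H_def)
  have d3: "((\<lambda>y. y\<^sup>2 * w t y) has_real_derivative 2 * y * w t y + y\<^sup>2 * dz 1 w t y) (at y)" if "y < 0" for y
    using d0[OF that] by (auto intro!: derivative_eq_intros)
  have c3: "continuous_on {..<0} (\<lambda>y. 2 * y * w t y + y\<^sup>2 * dz 1 w t y)"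
    by (intro continuous_intros c0 c1)
  \<comment> \<open>Weak differentiability of the product is not part of \<open>Dom_H\<close>; it
    follows from the classical derivative.\<close>
  have 3: "AE y in half_line. weak_deriv (\<lambda>y. y\<^sup>2 * w t y) y = 2 * y * w t y + y\<^sup>2 * dz 1 w t y"
    using classical_has_weak_deriv[OF d3 c3]
    by (intro weak_deriv_eq_classical[OF d3 c3]) (auto simp: weakly_differentiable_def)
  have "AE y in half_line. dt w t y = H_op (w t) y"
    using w t unfolding smooth_solution_def by blast
  with 1 2 3 show "AE y in half_line. dt w t y
      = - y * dz 2 w t y - 3 * dz 1 w t y + (y\<^sup>2 / 4 * dz 1 w t y + y / 2 * dz 0 w t y)"
    by eventually_elim (simp add: H_op_def algebra_simps)
qed

lemma smooth_solution_classical: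
  assumes w: "smooth_solution w"
  shows "classical_solution (dz 0 w) (dz 1 w) (dz 2 w) (dz 3 w)"
proof
  fix t z :: real
  assume tz: "0 \<le> t" "z < 0"
  note d = smooth_solution_dz_DERIV[OF w tz]
  show "(dz 0 w t has_real_derivative dz 1 w t z) (at z)" using d[of 0] by simp
  show "(dz 1 w t has_real_derivative dz 2 w t z) (at z)" using d[of 1] by (simp add: numeral_2_eq_2)
  show "(dz 2 w t has_real_derivative dz 3 w t z) (at z)" using d[of 2] by (simp add: numeral_3_eq_3 numeral_2_eq_2)
  have "(\<lambda>s. w s z) differentiable (at t within {0..})"
    using w tz unfolding smooth_solution_def sufficiently_smooth_def by blast
  then have "((\<lambda>s. w s z) has_real_derivative dt w t z) (at t within {0..})"
    by (simp add: dt_def vector_derivative_works has_real_derivative_iff_has_vector_derivative)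
  then show "((\<lambda>s. dz 0 w s z) has_real_derivative
      - z * dz 2 w t z - 3 * dz 1 w t z + (z\<^sup>2 / 4 * dz 1 w t z + z / 2 * dz 0 w t z)) (at t within {0..})"
    using smooth_solution_dt[OF w tz] by simp
next
  fix T :: real
  assume "0 \<le> T"
  then obtain M where "\<forall>t\<in>{0..T}. \<forall>z<0. \<forall>j\<le>3. (1 + \<bar>z\<bar>)\<^sup>2 * \<bar>dz j w t z\<bar> \<le> M"
    using w unfolding smooth_solution_def sufficient_decay_def by blast
  then show "\<exists>M. \<forall>t\<in>{0..T}. \<forall>z<0. (1 + \<bar>z\<bar>)\<^sup>2 * \<bar>dz 0 w t z\<bar> \<le> M \<and>
      (1 + \<bar>z\<bar>)\<^sup>2 * \<bar>dz 1 w t z\<bar> \<le> M \<and> (1 + \<bar>z\<bar>)\<^sup>2 * \<bar>dz 2 w t z\<bar> \<le> M"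
    by (intro exI[of _ M]) (auto simp del: dz_0)
qed (auto intro!: smooth_solution_dz_continuous[OF w, THEN continuous_up_to_boundary_interior] simp del: dz_0)

text \<open>Membership in \<open>H1\<close> provides some square integrable weak derivative
  \<open>g\<close>, while \<open>H1_norm\<close> uses the chosen \<open>weak_deriv u\<close>. Both
  equal the classical \<open>u'\<close> almost everywhere, so integrability is carried over from the
  former and the value from the latter.\<close>

lemma integral_le_H1_norm:
  assumes u: "u \<in> H1" and d: "\<And>z. z < 0 \<Longrightarrow> (u has_real_derivative u' z) (at z)"
    and c: "continuous_on {..<0} u'" and b: "b < 0"
  shows "integral {a..b} (\<lambda>z. (u z)\<^sup>2 + (u' z)\<^sup>2) \<le> (H1_norm u)\<^sup>2"
proof -
  let ?Q = "\<lambda>z. (u z)\<^sup>2 + (u' z)\<^sup>2"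
  obtain g where g: "g \<in> L2" "has_weak_deriv u g" using u by (auto simp: H1_def)
  have k: "has_weak_deriv u (weak_deriv u)" using g(2) unfolding weak_deriv_def by (metis someI)
  have [measurable]: "u' \<in> borel_measurable half_line"
    using c by (intro continuous_imp_measurable_on_sets_lebesgue) auto
  have [measurable]: "weak_deriv u \<in> borel_measurable half_line" "g \<in> borel_measurable half_line"
    using k g by (auto simp: has_weak_deriv_def intro: L1_loc_measurable)
  have ae: "AE z in half_line. g z = u' z" "AE z in half_line. weak_deriv u z = u' z"
    using has_weak_deriv_unique[OF _ classical_has_weak_deriv[OF d c]] g(2) k by auto
  have iu: "integrable half_line (\<lambda>z. (u z)\<^sup>2)" using u by (auto simp: H1_def L2_def)
  have "integrable half_line (\<lambda>z. (g z)\<^sup>2)" using g by (auto simp: L2_def)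
  moreover have "AE z in half_line. (g z)\<^sup>2 = (u' z)\<^sup>2" using ae(1) by eventually_elim simp
  ultimately have iu': "integrable half_line (\<lambda>z. (u' z)\<^sup>2)"
    by (subst integrable_cong_AE[symmetric, of "\<lambda>z. (g z)\<^sup>2"]) auto
  have "(LINT z|half_line. (weak_deriv u z)\<^sup>2) = (LINT z|half_line. (u' z)\<^sup>2)"
    by (intro integral_cong_AE) (use ae(2) in auto)
  then have eq: "(H1_norm u)\<^sup>2 = (LINT z|half_line. ?Q z)"
    using iu iu' by (simp add: H1_norm_def L2_norm_def integral_nonneg_AE)
  have iQ: "integrable half_line ?Q" using iu iu' by simp
  have "continuous_on {..<0} u" using d by (intro has_real_derivative_imp_continuous_on) auto
  then have "?Q integrable_on {a..b}"
    using b c by (intro integrable_continuous_real continuous_intros) (auto elim!: continuous_on_subset)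
  then have "integral {a..b} ?Q \<le> integral {..<0} ?Q"
    using b integrable_on_lebesgue_on[OF iQ] by (intro integral_subset_le) auto
  also have "\<dots> = (H1_norm u)\<^sup>2" unfolding eq using lebesgue_integral_eq_integral[OF iQ] by simp
  finally show ?thesis .
qed

theorem lemma6p5:
  shows "\<exists>\<alpha>>0. \<exists>C>0. \<forall>w. smooth_solution w \<longrightarrow>
    (\<forall>t\<ge>0. Linf_norm (w t) \<le> ereal (C * H1_norm (w 0) * exp (- \<alpha> * t)))"
proof (rule exI[of _ "1/2"], intro conjI exI[of _ 1] allI impI)
  fix w :: "real \<Rightarrow> real \<Rightarrow> real" and t :: real
  assume w: "smooth_solution w" and t: "0 \<le> t"
  interpret classical_solution "dz 0 w" "dz 1 w" "dz 2 w" "dz 3 w"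
    by (rule smooth_solution_classical[OF w])
  have H: "w 0 \<in> H1" and m: "w t \<in> borel_measurable half_line"
    using w t by (auto simp: smooth_solution_def H1_def L2_def)
  have N: "energy a b 0 \<le> (H1_norm (w 0))\<^sup>2" if "b < 0" for a b
    unfolding energy_def dz_0 using d0[of 0] that
    by (intro integral_le_H1_norm[OF H] continuous_up_to_boundary_slice smooth_solution_dz_continuous[OF w]) auto
  have "\<bar>w t z\<bar> \<le> 1 * H1_norm (w 0) * exp (- (1/2) * t)" if "z < 0" for z
  proof (rule power2_le_imp_le)
    \<comment> \<open>The energy bound controls the square of the solution by
      \<open>exp (- t)\<close>, the square of \<open>exp (- t / 2)\<close>; hence the rate
      1/2.\<close>
    show "\<bar>w t z\<bar>\<^sup>2 \<le> (1 * H1_norm (w 0) * exp (- (1/2) * t))\<^sup>2"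
      using pointwise_decay[OF N t that] exp_double[of "- (1/2) * t"] by (simp add: power_mult_distrib mult.commute)
    show "0 \<le> 1 * H1_norm (w 0) * exp (- (1/2) * t)" by (simp add: H1_norm_def)
  qed
  then have "AE z in half_line. ereal \<bar>w t z\<bar> \<le> ereal (1 * H1_norm (w 0) * exp (- (1/2) * t))"
    by (intro AE_I2) simp
  then show "Linf_norm (w t) \<le> ereal (1 * H1_norm (w 0) * exp (- (1/2) * t))"
    unfolding Linf_norm_def using m by (intro esssup_I) auto
qed simp_all

end
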